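(* Let $F:\mathcal{A}\to\mathcal{C}$ be a faithful $\mathcal{M}$-fibration and let $\mathcal{S}$ be a simple co-perfect syntopogenous structure on $\mathcal{C}$ with respect to $\mathcal{M}$, i.e. $\mathcal{S}_X=\{\sqsubset_X\}$ for every $X\in\mathcal{C}$, where $\sqsubset$ is a $\bigwedge$-preserving interpolative topogenous order on $\mathcal{C}$. Then $$c^{\sqsubset^F}_X(m)=\delta_X\big(c^{\sqsubset}_{FX}(Fm)\big)\qquad(m\in\mathrm{sub}X,\ X\in\mathcal{A})$$ defines an idempotent closure operator on $\mathcal{A}$ with respect to $\mathcal{M}_F$. It is the largest closure operator on $\mathcal{A}$ for which $F$ is $(c^{\sqsubset^F},c^{\sqsubset})$-continuous.
   Context: $\mathcal{C}$ is a category with a proper $(\mathcal{E},\mathcal{M})$-factorization system for morphisms ($\mathcal{E}$ consists of epimorphisms, $\mathcal{M}$ of monomorphisms), and it is $\mathcal{M}$-complete: pullbacks of $\mathcal{M}$-morphisms along arbitrary morphisms and arbitrary $\mathcal{M}$-intersections exist and are again in $\mathcal{M}$. For $X\in\mathcal{C}$, $\mathrm{sub}X=\{m\in\mathcal{M}\mid \mathrm{cod}(m)=X\}$, ordered by $n\le m$ iff $m\circ j=n$ for some $j$; isomorphic subobjects are identified, so $\mathrm{sub}X$ is a (possibly large) complete lattice. For $f:X\to Y$, $f(m)$ is the $\mathcal{M}$-component of the factorization of $f\circ m$ and $f^{-1}(n)$ is the pullback of $n$ along $f$. A morphism $f:X\to Y$ of $\mathcal{A}$ is $F$-initial ($F$-cartesian)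 if for every $h:Z\to Y$ in $\mathcal{A}$ and $u:FZ\to FX$ with $Ff\circ u=Fh$ there is a unique $v:Z\to X$ with $Fv=u$ and $f\circ v=h$; $\mathrm{Ini}F$ is the class of these. A faithful functor $F:\mathcal{A}\to\mathcal{C}$ is an $\mathcal{M}$-fibration if every $g:A\to FY$ with $g\in\mathcal{M}$ has an $F$-initial lifting. Then $\mathcal{A}$ carries the factorization system $(\mathcal{E}_F,\mathcal{M}_F)$, $\mathcal{E}_F=F^{-1}\mathcal{E}$, $\mathcal{M}_F=F^{-1}\mathcal{M}\cap\mathrm{Ini}F$, and is $\mathcal{M}_F$-complete; for $X\in\mathcal{A}$, $\mathrm{sub}X$ and images/inverse images are formed with respect to $\mathcal{M}_F$. The maps $\gamma_X:\mathrm{sub}X\to\mathrm{sub}FX$, $\gamma_X(m)=Fm$, and $\delta_X:\mathrm{sub}FX\to\mathrm{sub}X$, $\delta_X(n)=p$ with $Fp=n$ and $p\in\mathrm{Ini}F$, are mutually inverse order equivalences, and $F$ preserves images and inverse images of subobjects. A topogenous order on $\mathcal{C}$ is a family of relations $\sqsubset_X$ on $\mathrm{sub}X$ with (T1) $m\sqsubset_X n\Rightarrow m\le n$; (T2) $m\le n\sqsubset_X p\le q\Rightarrow m\sqsubset_X q$; (T3) for every $f:X\to Y$, $m\sqsubset_Y n\Rightarrow f^{-1}(m)\sqsubset_X f^{-1}(n)$. It is $\bigwedge$-preserving if ($m\sqsubset_X n_i$ for all $i\in I$) implies $m\sqsubset_X\bigwedge n_i$, and interpolative if $m\sqsubset_X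 n$ implies $m\sqsubset_X p\sqsubset_X n$ for some $p$. For such $\sqsubset$, $c^{\sqsubset}_X(m)=\bigwedge\{p\mid m\sqsubset_X p\}$. A closure operator $c$ (on $\mathcal{C}$ with respect to $\mathcal{M}$, or on $\mathcal{A}$ with respect to $\mathcal{M}_F$) is a family of maps $c_X:\mathrm{sub}X\to\mathrm{sub}X$ with (C1) $m\le c_X(m)$; (C2) $m\le n\Rightarrow c_X(m)\le c_X(n)$; (C3) $f(c_X(m))\le c_Y(f(m))$ for every $f:X\to Y$ and $m\in\mathrm{sub}X$. It is idempotent if $c_X(c_X(m))=c_X(m)$. Order: $c\le c'$ iff $c_X(m)\le c'_X(m)$ for all $X$ and $m$. For closure operators $c'$ on $\mathcal{A}$ and $c$ on $\mathcal{C}$, $F$ is $(c',c)$-continuous if $F(c'_X(m))\le c_{FX}(Fm)$ for all $X\in\mathcal{A}$, $m\in\mathrm{sub}X$. *)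

theory Defs
  imports "HOL-Algebra.Complete_Lattice"
begin

text \<open>\<open>g \<cdot> f\<close> is "g after f"; its value is irrelevant unless \<open>Dom C g = Cod C f\<close>.\<close>

record ('o, 'a) cat =
  Ob :: "'o set"
  Ar :: "'a set"
  Dom :: "'a \<Rightarrow> 'o"
  Cod :: "'a \<Rightarrow> 'o"
  Ide :: "'o \<Rightarrow> 'a"
  Comp :: "'a \<Rightarrow> 'a \<Rightarrow> 'a"  (infixr \<open>\<cdot>\<index>\<close> 75)

definition Hom :: "('o, 'a) cat \<Rightarrow> 'o \<Rightarrow> 'o \<Rightarrow> 'a set" where
  "Hom C X Y = {f \<in> Ar C. Dom C f = X \<and> Cod C f = Y}"

locale category =
  fixes C :: "('o, 'a) cat" (structure)
  assumes Dom_in_Ob: "f \<in> Ar C \<Longrightarrow> Dom C f \<in> Ob C"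
    and Cod_in_Ob: "f \<in> Ar C \<Longrightarrow> Cod C f \<in> Ob C"
    and Ide_in_Hom: "X \<in> Ob C \<Longrightarrow> Ide C X \<in> Hom C X X"
    and Comp_in_Hom: "f \<in> Hom C X Y \<Longrightarrow> g \<in> Hom C Y Z \<Longrightarrow> g \<cdot> f \<in> Hom C X Z"
    and Comp_Ide: "f \<in> Hom C X Y \<Longrightarrow> f \<cdot> Ide C X = f"
    and Ide_Comp: "f \<in> Hom C X Y \<Longrightarrow> Ide C Y \<cdot> f = f"
    and Comp_assoc: "f \<in> Hom C W X \<Longrightarrow> g \<in> Hom C X Y \<Longrightarrow> h \<in> Hom C Y Z
      \<Longrightarrow> (h \<cdot> g) \<cdot> f = h \<cdot> (g \<cdot> f)"

definition mono_arr :: "('o, 'a) cat \<Rightarrow> 'a \<Rightarrow> bool" where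
  "mono_arr C m \<longleftrightarrow> m \<in> Ar C \<and>
    (\<forall>Z. \<forall>f\<in>Hom C Z (Dom C m). \<forall>g\<in>Hom C Z (Dom C m). m \<cdot>\<^bsub>C\<^esub> f = m \<cdot>\<^bsub>C\<^esub> g \<longrightarrow> f = g)"

definition epi_arr :: "('o, 'a) cat \<Rightarrow> 'a \<Rightarrow> bool" where
  "epi_arr C e \<longleftrightarrow> e \<in> Ar C \<and>
    (\<forall>Z. \<forall>f\<in>Hom C (Cod C e) Z. \<forall>g\<in>Hom C (Cod C e) Z. f \<cdot>\<^bsub>C\<^esub> e = g \<cdot>\<^bsub>C\<^esub> e \<longrightarrow> f = g)"

definition iso_arr :: "('o, 'a) cat \<Rightarrow> 'a \<Rightarrow> bool" where
  "iso_arr C f \<longleftrightarrow> f \<in> Ar C \<and>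
    (\<exists>g\<in>Hom C (Cod C f) (Dom C f).
      g \<cdot>\<^bsub>C\<^esub> f = Ide C (Dom C f) \<and> f \<cdot>\<^bsub>C\<^esub> g = Ide C (Cod C f))"

definition is_pullback :: "('o, 'a) cat \<Rightarrow> 'a \<Rightarrow> 'a \<Rightarrow> 'a \<Rightarrow> 'a \<Rightarrow> bool" where
  \<comment> \<open>\<open>p\<close> is the pullback of \<open>n\<close> along \<open>f\<close>, with second projection \<open>q\<close>: \<open>f \<cdot> p = n \<cdot> q\<close>\<close>
  "is_pullback C f n p q \<longleftrightarrow>
    f \<in> Ar C \<and> n \<in> Ar C \<and> Cod C f = Cod C n \<and>
    p \<in> Hom C (Dom C p) (Dom C f) \<and> q \<in> Hom C (Dom C p) (Dom C n) \<and>
    f \<cdot>\<^bsub>C\<^esub> p = n \<cdot>\<^bsub>C\<^esub> q \<and>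
    (\<forall>Z. \<forall>u\<in>Hom C Z (Dom C f). \<forall>v\<in>Hom C Z (Dom C n). f \<cdot>\<^bsub>C\<^esub> u = n \<cdot>\<^bsub>C\<^esub> v \<longrightarrow>
      (\<exists>!h. h \<in> Hom C Z (Dom C p) \<and> p \<cdot>\<^bsub>C\<^esub> h = u \<and> q \<cdot>\<^bsub>C\<^esub> h = v))"

text \<open>On \<open>\<M>\<close>-morphisms with a common codomain this is the subobject order \<open>f \<le> m\<close>.\<close>

definition factors_through :: "('o, 'a) cat \<Rightarrow> 'a \<Rightarrow> 'a \<Rightarrow> bool" where
  "factors_through C f m \<longleftrightarrow> (\<exists>j\<in>Hom C (Dom C f) (Dom C m). m \<cdot>\<^bsub>C\<^esub> j = f)"

text \<open>The intersection (wide pullback) of a family \<open>K\<close> of monomorphisms with codomain \<open>X\<close>.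
  As the members of \<open>K\<close> are monic, a cone over \<open>K\<close> is just a morphism into \<open>X\<close> that factors
  through every member. For \<open>K = {}\<close> the intersection is an isomorphism onto \<open>X\<close>.\<close>

definition is_intersection :: "('o, 'a) cat \<Rightarrow> 'o \<Rightarrow> 'a set \<Rightarrow> 'a \<Rightarrow> bool" where
  "is_intersection C X K m \<longleftrightarrow>
    m \<in> Ar C \<and> Cod C m = X \<and> (\<forall>k\<in>K. factors_through C m k) \<and>
    (\<forall>f\<in>Ar C. Cod C f = X \<and> (\<forall>k\<in>K. factors_through C f k) \<longrightarrow>
      (\<exists>!h. h \<in> Hom C (Dom C f) (Dom C m) \<and> m \<cdot>\<^bsub>C\<^esub> h = f))"

locale proper_factorization_system = category C
  for C :: "('o, 'a) cat" (structure) and E M :: "'a set" +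
  assumes E_epi: "e \<in> E \<Longrightarrow> epi_arr C e"
    and M_mono: "m \<in> M \<Longrightarrow> mono_arr C m"
    and iso_Comp_E: "e \<in> E \<Longrightarrow> iso_arr C h \<Longrightarrow> Dom C h = Cod C e \<Longrightarrow> h \<cdot> e \<in> E"
    and M_Comp_iso: "m \<in> M \<Longrightarrow> iso_arr C h \<Longrightarrow> Cod C h = Dom C m \<Longrightarrow> m \<cdot> h \<in> M"
    and factorization: "f \<in> Ar C \<Longrightarrow> \<exists>e\<in>E. \<exists>m\<in>M. Cod C e = Dom C m \<and> f = m \<cdot> e"
    and diagonal: "e \<in> E \<Longrightarrow> m \<in> M \<Longrightarrow>
      u \<in> Hom C (Dom C e) (Dom C m) \<Longrightarrow> v \<in> Hom C (Cod C e) (Cod C m) \<Longrightarrow> m \<cdot> u = v \<cdot> e \<Longrightarrow>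
      \<exists>!d. d \<in> Hom C (Cod C e) (Dom C m) \<and> d \<cdot> e = u \<and> m \<cdot> d = v"

locale M_complete_category = proper_factorization_system C E M
  for C :: "('o, 'a) cat" (structure) and E M :: "'a set" +
  assumes M_pullback: "n \<in> M \<Longrightarrow> f \<in> Ar C \<Longrightarrow> Cod C f = Cod C n \<Longrightarrow>
      \<exists>p\<in>M. \<exists>q. is_pullback C f n p q"
    and M_intersection: "X \<in> Ob C \<Longrightarrow> K \<subseteq> {m \<in> M. Cod C m = X} \<Longrightarrow>
      \<exists>m\<in>M. is_intersection C X K m"

text \<open>A subobject of \<open>X\<close> is an isomorphism class of \<open>\<M>\<close>-morphisms with codomain \<open>X\<close>. Operations
  on subobjects are lifted from representatives by taking the union of the classes of all results,
  which is again a single class because the result is unique up to isomorphism.\<close>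

definition sub_iso :: "('o, 'a) cat \<Rightarrow> 'a set \<Rightarrow> 'o \<Rightarrow> ('a \<times> 'a) set" where
  "sub_iso C M X = {(m, n). m \<in> M \<and> n \<in> M \<and> Cod C m = X \<and> Cod C n = X \<and>
    (\<exists>j\<in>Hom C (Dom C m) (Dom C n). iso_arr C j \<and> n \<cdot>\<^bsub>C\<^esub> j = m)}"

definition sub :: "('o, 'a) cat \<Rightarrow> 'a set \<Rightarrow> 'o \<Rightarrow> 'a set gorder" where
  "sub C M X = \<lparr>carrier = {m \<in> M. Cod C m = X} // sub_iso C M X, eq = (=),
    le = (\<lambda>P Q. \<exists>n\<in>P. \<exists>m\<in>Q. factors_through C n m)\<rparr>"

definition sub_image :: "('o, 'a) cat \<Rightarrow> 'a set \<Rightarrow> 'a set \<Rightarrow> 'a \<Rightarrow> 'a set \<Rightarrow> 'a set" where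
  "sub_image C E M f P =
    (\<Union>m\<in>P. \<Union>m'\<in>{m' \<in> M. \<exists>e\<in>E. Cod C e = Dom C m' \<and> f \<cdot>\<^bsub>C\<^esub> m = m' \<cdot>\<^bsub>C\<^esub> e}.
      sub_iso C M (Cod C f) `` {m'})"

definition sub_preimage :: "('o, 'a) cat \<Rightarrow> 'a set \<Rightarrow> 'a \<Rightarrow> 'a set \<Rightarrow> 'a set" where
  "sub_preimage C M f Q =
    (\<Union>n\<in>Q. \<Union>p\<in>{p. \<exists>q. is_pullback C f n p q}. sub_iso C M (Dom C f) `` {p})"

text \<open>A family indexed by the objects is a function on the whole object type; only its values at
  objects of the category and at their subobjects matter.\<close>

definition closure_operator ::
    "('o, 'a) cat \<Rightarrow> 'a set \<Rightarrow> 'a set \<Rightarrow> ('o \<Rightarrow> 'a set \<Rightarrow> 'a set) \<Rightarrow> bool" where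
  "closure_operator C E M c \<longleftrightarrow>
    (\<forall>X\<in>Ob C. c X \<in> carrier (sub C M X) \<rightarrow> carrier (sub C M X)) \<and>
    (\<forall>X\<in>Ob C. \<forall>m\<in>carrier (sub C M X). m \<sqsubseteq>\<^bsub>sub C M X\<^esub> c X m) \<and>
    (\<forall>X\<in>Ob C. \<forall>m\<in>carrier (sub C M X). \<forall>n\<in>carrier (sub C M X).
      m \<sqsubseteq>\<^bsub>sub C M X\<^esub> n \<longrightarrow> c X m \<sqsubseteq>\<^bsub>sub C M X\<^esub> c X n) \<and>
    (\<forall>X\<in>Ob C. \<forall>Y\<in>Ob C. \<forall>f\<in>Hom C X Y. \<forall>m\<in>carrier (sub C M X).
      sub_image C E M f (c X m) \<sqsubseteq>\<^bsub>sub C M Y\<^esub> c Y (sub_image C E M f m))"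

definition idempotent_closure ::
    "('o, 'a) cat \<Rightarrow> 'a set \<Rightarrow> ('o \<Rightarrow> 'a set \<Rightarrow> 'a set) \<Rightarrow> bool" where
  "idempotent_closure C M c \<longleftrightarrow>
    (\<forall>X\<in>Ob C. \<forall>m\<in>carrier (sub C M X). c X (c X m) = c X m)"

definition closure_le :: "('o, 'a) cat \<Rightarrow> 'a set \<Rightarrow>
    ('o \<Rightarrow> 'a set \<Rightarrow> 'a set) \<Rightarrow> ('o \<Rightarrow> 'a set \<Rightarrow> 'a set) \<Rightarrow> bool" where
  "closure_le C M c c' \<longleftrightarrow>
    (\<forall>X\<in>Ob C. \<forall>m\<in>carrier (sub C M X). c X m \<sqsubseteq>\<^bsub>sub C M X\<^esub> c' X m)"

definition topogenous_order ::
    "('o, 'a) cat \<Rightarrow> 'a set \<Rightarrow> ('o \<Rightarrow> 'a set \<Rightarrow> 'a set \<Rightarrow> bool) \<Rightarrow> bool" where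
  "topogenous_order C M R \<longleftrightarrow>
    (\<forall>X\<in>Ob C. \<forall>m n. R X m n \<longrightarrow> m \<in> carrier (sub C M X) \<and> n \<in> carrier (sub C M X)) \<and>
    (\<forall>X\<in>Ob C. \<forall>m n. R X m n \<longrightarrow> m \<sqsubseteq>\<^bsub>sub C M X\<^esub> n) \<and>
    (\<forall>X\<in>Ob C. \<forall>m\<in>carrier (sub C M X). \<forall>n p. \<forall>q\<in>carrier (sub C M X).
      m \<sqsubseteq>\<^bsub>sub C M X\<^esub> n \<and> R X n p \<and> p \<sqsubseteq>\<^bsub>sub C M X\<^esub> q \<longrightarrow> R X m q) \<and>
    (\<forall>X\<in>Ob C. \<forall>Y\<in>Ob C. \<forall>f\<in>Hom C X Y. \<forall>m n. R Y m n \<longrightarrow>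
      R X (sub_preimage C M f m) (sub_preimage C M f n))"

text \<open>The empty meet (the top subobject) is included.\<close>

definition Meet_preserving ::
    "('o, 'a) cat \<Rightarrow> 'a set \<Rightarrow> ('o \<Rightarrow> 'a set \<Rightarrow> 'a set \<Rightarrow> bool) \<Rightarrow> bool" where
  "Meet_preserving C M R \<longleftrightarrow>
    (\<forall>X\<in>Ob C. \<forall>m\<in>carrier (sub C M X). \<forall>N. N \<subseteq> carrier (sub C M X) \<and> (\<forall>n\<in>N. R X m n) \<longrightarrow>
      R X m (\<Sqinter>\<^bsub>sub C M X\<^esub> N))"

definition interpolative ::
    "('o, 'a) cat \<Rightarrow> 'a set \<Rightarrow> ('o \<Rightarrow> 'a set \<Rightarrow> 'a set \<Rightarrow> bool) \<Rightarrow> bool" where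
  "interpolative C M R \<longleftrightarrow>
    (\<forall>X\<in>Ob C. \<forall>m n. R X m n \<longrightarrow> (\<exists>p\<in>carrier (sub C M X). R X m p \<and> R X p n))"

definition simple_coperfect_syntopogenous :: "('o, 'a) cat \<Rightarrow> 'a set \<Rightarrow>
    ('o \<Rightarrow> ('a set \<Rightarrow> 'a set \<Rightarrow> bool) set) \<Rightarrow> ('o \<Rightarrow> 'a set \<Rightarrow> 'a set \<Rightarrow> bool) \<Rightarrow> bool" where
  "simple_coperfect_syntopogenous C M S R \<longleftrightarrow>
    (\<forall>X\<in>Ob C. S X = {R X}) \<and>
    topogenous_order C M R \<and> Meet_preserving C M R \<and> interpolative C M R"

definition topogenous_closure :: "('o, 'a) cat \<Rightarrow> 'a set \<Rightarrow>
    ('o \<Rightarrow> 'a set \<Rightarrow> 'a set \<Rightarrow> bool) \<Rightarrow> 'o \<Rightarrow> 'a set \<Rightarrow> 'a set" where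
  "topogenous_closure C M R X m = \<Sqinter>\<^bsub>sub C M X\<^esub> {p \<in> carrier (sub C M X). R X m p}"

locale faithful_functor = A: category A + C: category C
  for A :: "('p, 'b) cat" and C :: "('o, 'a) cat" and Fo :: "'p \<Rightarrow> 'o" and Fa :: "'b \<Rightarrow> 'a" +
  assumes Fo_in_Ob: "X \<in> Ob A \<Longrightarrow> Fo X \<in> Ob C"
    and Fa_in_Hom: "f \<in> Hom A X Y \<Longrightarrow> Fa f \<in> Hom C (Fo X) (Fo Y)"
    and Fa_Ide: "X \<in> Ob A \<Longrightarrow> Fa (Ide A X) = Ide C (Fo X)"
    and Fa_Comp: "f \<in> Hom A X Y \<Longrightarrow> g \<in> Hom A Y Z \<Longrightarrow> Fa (g \<cdot>\<^bsub>A\<^esub> f) = Fa g \<cdot>\<^bsub>C\<^esub> Fa f"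
    and faithful: "f \<in> Hom A X Y \<Longrightarrow> g \<in> Hom A X Y \<Longrightarrow> Fa f = Fa g \<Longrightarrow> f = g"

definition Ini :: "('p, 'b) cat \<Rightarrow> ('o, 'a) cat \<Rightarrow> ('p \<Rightarrow> 'o) \<Rightarrow> ('b \<Rightarrow> 'a) \<Rightarrow> 'b set" where
  "Ini A C Fo Fa = {f \<in> Ar A. \<forall>Z\<in>Ob A. \<forall>h\<in>Hom A Z (Cod A f). \<forall>u\<in>Hom C (Fo Z) (Fo (Dom A f)).
    Fa f \<cdot>\<^bsub>C\<^esub> u = Fa h \<longrightarrow> (\<exists>!v. v \<in> Hom A Z (Dom A f) \<and> Fa v = u \<and> f \<cdot>\<^bsub>A\<^esub> v = h)}"

locale faithful_M_fibration = faithful_functor A C Fo Fa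
  for A :: "('p, 'b) cat" and C :: "('o, 'a) cat" and M :: "'a set"
    and Fo :: "'p \<Rightarrow> 'o" and Fa :: "'b \<Rightarrow> 'a" +
  assumes initial_lifting: "Y \<in> Ob A \<Longrightarrow> g \<in> M \<Longrightarrow> Cod C g = Fo Y \<Longrightarrow>
    \<exists>f\<in>Ini A C Fo Fa. Cod A f = Y \<and> Fa f = g"

definition E_lift :: "('p, 'b) cat \<Rightarrow> 'a set \<Rightarrow> ('b \<Rightarrow> 'a) \<Rightarrow> 'b set" where
  "E_lift A E Fa = {e \<in> Ar A. Fa e \<in> E}"

definition M_lift :: "('p, 'b) cat \<Rightarrow> ('o, 'a) cat \<Rightarrow> 'a set \<Rightarrow> ('p \<Rightarrow> 'o) \<Rightarrow> ('b \<Rightarrow> 'a) \<Rightarrow> 'b set" where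
  "M_lift A C M Fo Fa = {m \<in> Ar A. Fa m \<in> M} \<inter> Ini A C Fo Fa"

definition sub_gamma :: "('o, 'a) cat \<Rightarrow> 'a set \<Rightarrow> ('p \<Rightarrow> 'o) \<Rightarrow> ('b \<Rightarrow> 'a) \<Rightarrow>
    'p \<Rightarrow> 'b set \<Rightarrow> 'a set" where
  "sub_gamma C M Fo Fa X P = (\<Union>m\<in>P. sub_iso C M (Fo X) `` {Fa m})"

definition sub_delta :: "('p, 'b) cat \<Rightarrow> ('o, 'a) cat \<Rightarrow> 'a set \<Rightarrow> ('p \<Rightarrow> 'o) \<Rightarrow> ('b \<Rightarrow> 'a) \<Rightarrow>
    'p \<Rightarrow> 'a set \<Rightarrow> 'b set" where
  "sub_delta A C M Fo Fa X Q =
    (\<Union>n\<in>Q. \<Union>p\<in>{p \<in> Ini A C Fo Fa. Cod A p = X \<and> Fa p = n}.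
      sub_iso A (M_lift A C M Fo Fa) X `` {p})"

definition lifted_closure :: "('p, 'b) cat \<Rightarrow> ('o, 'a) cat \<Rightarrow> 'a set \<Rightarrow> ('p \<Rightarrow> 'o) \<Rightarrow> ('b \<Rightarrow> 'a) \<Rightarrow>
    ('o \<Rightarrow> 'a set \<Rightarrow> 'a set \<Rightarrow> bool) \<Rightarrow> 'p \<Rightarrow> 'b set \<Rightarrow> 'b set" where
  "lifted_closure A C M Fo Fa R X m =
    sub_delta A C M Fo Fa X (topogenous_closure C M R (Fo X) (sub_gamma C M Fo Fa X m))"

definition continuous_functor :: "('p, 'b) cat \<Rightarrow> ('o, 'a) cat \<Rightarrow> 'a set \<Rightarrow>
    ('p \<Rightarrow> 'o) \<Rightarrow> ('b \<Rightarrow> 'a) \<Rightarrow>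
    ('p \<Rightarrow> 'b set \<Rightarrow> 'b set) \<Rightarrow> ('o \<Rightarrow> 'a set \<Rightarrow> 'a set) \<Rightarrow> bool" where
  "continuous_functor A C M Fo Fa c' c \<longleftrightarrow>
    (\<forall>X\<in>Ob A. \<forall>m\<in>carrier (sub A (M_lift A C M Fo Fa) X).
      sub_gamma C M Fo Fa X (c' X m) \<sqsubseteq>\<^bsub>sub C M (Fo X)\<^esub> c (Fo X) (sub_gamma C M Fo Fa X m))"

end

theory Submission
  imports Defs
begin

text \<open>Since \<open>\<sqsubset>\<close> preserves meets, \<open>m \<sqsubset> c m\<close> holds for the closure \<open>c\<close> it induces, and interpolation
  sharpens this to \<open>c m \<sqsubset> c m\<close>, so \<open>c\<close> is idempotent; its continuity follows from (T3) through the
  adjunction of image and inverse image. Passing to \<open>\<A>\<close> uses only that \<open>\<gamma> \<stileturn> \<delta>\<close>, \<open>\<gamma> \<circ> \<delta> = id\<close>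
  and that \<open>\<gamma>\<close> commutes with images. As \<open>\<gamma> P \<le> Q\<close> is equivalent to \<open>P \<le> \<delta> Q\<close>, the inequality
  \<open>\<gamma> (c' P) \<le> c (\<gamma> P)\<close> defining continuity says precisely \<open>c' P \<le> \<delta> (c (\<gamma> P))\<close>.\<close>

section \<open>Subobjects in a category with a proper factorization system\<close>

lemma Hom_iff: "f \<in> Hom C X Y \<longleftrightarrow> f \<in> Ar C \<and> Dom C f = X \<and> Cod C f = Y"
  by (simp add: Hom_def)

lemma closure_operator_closed:
  assumes "closure_operator C E M c" "X \<in> Ob C" "P \<in> carrier (sub C M X)"
  shows "c X P \<in> carrier (sub C M X)"
proof -
  have "c X \<in> carrier (sub C M X) \<rightarrow> carrier (sub C M X)"
    using assms(1,2) by (simp only: closure_operator_def)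
  then show ?thesis
    using assms(3) by (rule funcset_mem)
qed

section \<open>Arrows in a category and factoring through one another\<close>

context category
begin

lemma Comp_Ar:
  assumes "f \<in> Ar C" "g \<in> Ar C" "Cod C f = Dom C g"
  shows "g \<cdot> f \<in> Ar C" "Dom C (g \<cdot> f) = Dom C f" "Cod C (g \<cdot> f) = Cod C g"
  using Comp_in_Hom[of f "Dom C f" "Cod C f" g "Cod C g"] assms by (auto simp: Hom_iff)

lemma Comp_assoc_Ar:
  assumes "f \<in> Ar C" "g \<in> Ar C" "h \<in> Ar C" "Cod C f = Dom C g" "Cod C g = Dom C h"
  shows "(h \<cdot> g) \<cdot> f = h \<cdot> (g \<cdot> f)"
  using assms by (intro Comp_assoc) (auto simp: Hom_iff)

lemma Comp_Ide_Ar: "f \<in> Ar C \<Longrightarrow> Dom C f = X \<Longrightarrow> f \<cdot> Ide C X = f"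
  by (rule Comp_Ide) (auto simp: Hom_iff)

lemma Ide_Comp_Ar: "f \<in> Ar C \<Longrightarrow> Cod C f = X \<Longrightarrow> Ide C X \<cdot> f = f"
  by (rule Ide_Comp) (auto simp: Hom_iff)

lemma factors_through_Cod:
  assumes "factors_through C f m" "m \<in> Ar C"
  shows "f \<in> Ar C" "Cod C f = Cod C m"
  using assms Comp_Ar by (auto simp: factors_through_def Hom_iff)

lemma factors_through_refl: "m \<in> Ar C \<Longrightarrow> factors_through C m m"
  unfolding factors_through_def
  by (rule bexI[of _ "Ide C (Dom C m)"]) (simp_all add: Comp_Ide_Ar Ide_in_Hom Dom_in_Ob)

lemma factors_through_Comp:
  assumes "e \<in> Ar C" "m \<in> Ar C" "Cod C e = Dom C m"
  shows "factors_through C (m \<cdot> e) m"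
  using assms Comp_Ar[OF assms] by (auto simp: factors_through_def Hom_iff)

lemma factors_through_trans:
  assumes "factors_through C f m" "factors_through C m n" "n \<in> Ar C"
  shows "factors_through C f n"
proof -
  obtain j where j: "j \<in> Hom C (Dom C f) (Dom C m)" "m \<cdot> j = f"
    using assms(1) by (auto simp: factors_through_def)
  obtain k where k: "k \<in> Hom C (Dom C m) (Dom C n)" "n \<cdot> k = m"
    using assms(2) by (auto simp: factors_through_def)
  have "n \<cdot> (k \<cdot> j) = f"
    using Comp_assoc_Ar[of j k n] assms(3) j k by (auto simp: Hom_iff)
  then show ?thesis
    using Comp_in_Hom[OF j(1) k(1)] unfolding factors_through_def by blast
qed

lemma factors_through_Comp_left:
  assumes "factors_through C m n" "n \<in> Ar C" "f \<in> Ar C" "Dom C f = Cod C n"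
  shows "factors_through C (f \<cdot> m) (f \<cdot> n)"
proof -
  obtain j where j: "j \<in> Hom C (Dom C m) (Dom C n)" "n \<cdot> j = m"
    using assms(1) by (auto simp: factors_through_def)
  have "(f \<cdot> n) \<cdot> j = f \<cdot> m"
    using Comp_assoc_Ar[of j n f] assms j by (auto simp: Hom_iff)
  moreover have "m \<in> Ar C" "Cod C m = Cod C n"
    using factors_through_Cod[OF assms(1,2)] by auto
  ultimately show ?thesis
    using j Comp_Ar[of m f] Comp_Ar[of n f] assms unfolding factors_through_def
    by (intro bexI[of _ j]) auto
qed

text \<open>The factorizations in the two directions are mutually inverse:
  \<open>m \<cdot> (k \<cdot> j) = m\<close> and \<open>n \<cdot> (j \<cdot> k) = n\<close>, and the
  monomorphisms \<open>m\<close> and \<open>n\<close> cancel.\<close>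

lemma mono_mutual_factors_iso:
  assumes "mono_arr C m" "mono_arr C n" "factors_through C n m"
    and j: "j \<in> Hom C (Dom C m) (Dom C n)" "n \<cdot> j = m"
  shows "iso_arr C j"
proof -
  obtain k where k: "k \<in> Hom C (Dom C n) (Dom C m)" "m \<cdot> k = n"
    using assms(3) by (auto simp: factors_through_def)
  have mn: "m \<in> Ar C" "n \<in> Ar C"
    using assms by (auto simp: mono_arr_def)
  have "m \<cdot> (k \<cdot> j) = m \<cdot> Ide C (Dom C m)"
    using Comp_assoc_Ar[of j k m] mn j k by (auto simp: Hom_iff Comp_Ide_Ar)
  then have kj: "k \<cdot> j = Ide C (Dom C m)"
    using assms(1) Comp_in_Hom[OF j(1) k(1)] Ide_in_Hom Dom_in_Ob[OF mn(1)]
    unfolding mono_arr_def by blast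
  have "n \<cdot> (j \<cdot> k) = n \<cdot> Ide C (Dom C n)"
    using Comp_assoc_Ar[of k j n] mn j k by (auto simp: Hom_iff Comp_Ide_Ar)
  then have "j \<cdot> k = Ide C (Dom C n)"
    using assms(2) Comp_in_Hom[OF k(1) j(1)] Ide_in_Hom Dom_in_Ob[OF mn(2)]
    unfolding mono_arr_def by blast
  with kj j k show ?thesis
    unfolding iso_arr_def by (auto simp: Hom_iff)
qed

end

section \<open>Subobjects as classes of \<open>M\<close>-morphisms, their order and their
  images\<close>

context proper_factorization_system
begin

lemma M_Ar: "m \<in> M \<Longrightarrow> m \<in> Ar C"
  using M_mono by (auto simp: mono_arr_def)

lemma E_Ar: "e \<in> E \<Longrightarrow> e \<in> Ar C"
  using E_epi by (auto simp: epi_arr_def)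

lemma factors_through_trans_M:
  "factors_through C f m \<Longrightarrow> factors_through C m n \<Longrightarrow> n \<in> M \<Longrightarrow> factors_through C f n"
  using factors_through_trans M_Ar by blast

text \<open>Trades the isomorphism in \<open>sub_iso\<close> for mutual factoring. Equality of
  subobjects then becomes antisymmetry of the factoring preorder, and isomorphisms need not be
  handled again.\<close>

lemma sub_iso_iff:
  "(m, n) \<in> sub_iso C M X \<longleftrightarrow> m \<in> M \<and> n \<in> M \<and> Cod C m = X \<and> Cod C n = X \<and>
    factors_through C m n \<and> factors_through C n m" (is "?L \<longleftrightarrow> ?R")
proof
  assume ?L
  then obtain j where mn: "m \<in> M" "n \<in> M" "Cod C m = X" "Cod C n = X"
    and j: "j \<in> Hom C (Dom C m) (Dom C n)" "iso_arr C j" "n \<cdot> j = m"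
    by (auto simp: sub_iso_def)
  obtain k where k: "k \<in> Hom C (Dom C n) (Dom C m)" "j \<cdot> k = Ide C (Dom C n)"
    using j by (auto simp: iso_arr_def Hom_iff)
  have "m \<cdot> k = n"
    using Comp_assoc_Ar[of k j n] mn j k by (auto simp: Hom_iff M_Ar Comp_Ide_Ar)
  with mn j k show ?R
    unfolding factors_through_def by blast
next
  assume R: ?R
  then obtain j where "j \<in> Hom C (Dom C m) (Dom C n)" "n \<cdot> j = m"
    unfolding factors_through_def by blast
  with R show ?L
    using mono_mutual_factors_iso[of m n j] M_mono by (auto simp: sub_iso_def)
qed

lemma equiv_sub_iso: "equiv {m \<in> M. Cod C m = X} (sub_iso C M X)"
proof (rule equivI)
  show "sub_iso C M X \<subseteq> {m \<in> M. Cod C m = X} \<times> {m \<in> M. Cod C m = X}"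
    by (auto simp: sub_iso_def)
  show "refl_on {m \<in> M. Cod C m = X} (sub_iso C M X)"
    by (auto simp: refl_on_def sub_iso_iff factors_through_refl M_Ar)
  show "Relation.sym (sub_iso C M X)"
    by (auto simp: sym_def sub_iso_iff)
  show "Relation.trans (sub_iso C M X)"
    unfolding trans_def sub_iso_iff using factors_through_trans_M by blast
qed

lemma sub_cls_self: "m \<in> M \<Longrightarrow> Cod C m = X \<Longrightarrow> m \<in> sub_iso C M X `` {m}"
  by (simp add: sub_iso_iff factors_through_refl M_Ar)

lemma sub_cls_eq_iff:
  assumes "m \<in> M" "n \<in> M" "Cod C m = X" "Cod C n = X"
  shows "sub_iso C M X `` {m} = sub_iso C M X `` {n} \<longleftrightarrow>
    factors_through C m n \<and> factors_through C n m"
  using eq_equiv_class_iff[OF equiv_sub_iso, of m X n] assms by (auto simp: sub_iso_iff)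

lemma sub_cls_in_carrier:
  "m \<in> M \<Longrightarrow> Cod C m = X \<Longrightarrow> sub_iso C M X `` {m} \<in> carrier (sub C M X)"
  by (auto simp: sub_def intro!: quotientI)

lemma sub_carrierE:
  assumes "P \<in> carrier (sub C M X)"
  obtains m where "m \<in> M" "Cod C m = X" "P = sub_iso C M X `` {m}"
  using assms by (auto simp: sub_def elim!: quotientE)

text \<open>The order of \<open>sub\<close> asks only for some pair of representatives. Since
  equivalent representatives factor through each other, any such pair can be moved to the given
  \<open>m\<close> and \<open>n\<close> by transitivity.\<close>

lemma sub_le_iff:
  assumes "m \<in> M" "n \<in> M" "Cod C m = X" "Cod C n = X"
  shows "sub_iso C M X `` {m} \<sqsubseteq>\<^bsub>sub C M X\<^esub> sub_iso C M X `` {n} \<longleftrightarrow> factors_through C m n"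
proof -
  have "factors_through C m n"
    if "(m, m') \<in> sub_iso C M X" "(n, n') \<in> sub_iso C M X" "factors_through C m' n'" for m' n'
    using that factors_through_trans_M[of m m' n'] factors_through_trans_M[of m n' n]
    by (simp add: sub_iso_iff)
  moreover have "m \<in> sub_iso C M X `` {m}" "n \<in> sub_iso C M X `` {n}"
    using assms sub_cls_self by auto
  ultimately show ?thesis
    unfolding sub_def by auto
qed

lemma sub_le_refl: "P \<in> carrier (sub C M X) \<Longrightarrow> P \<sqsubseteq>\<^bsub>sub C M X\<^esub> P"
  by (elim sub_carrierE) (simp add: sub_le_iff factors_through_refl M_Ar)

lemma sub_le_antisym:
  assumes "P \<in> carrier (sub C M X)" "Q \<in> carrier (sub C M X)"
    and "P \<sqsubseteq>\<^bsub>sub C M X\<^esub> Q" "Q \<sqsubseteq>\<^bsub>sub C M X\<^esub> P"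
  shows "P = Q"
  using assms by (elim sub_carrierE) (simp add: sub_le_iff sub_cls_eq_iff)

text \<open>By orthogonality, the \<open>\<M>\<close>-part of \<open>f\<close> is the least \<open>\<M>\<close>-morphism through which \<open>f\<close>
  factors. This one fact gives independence of representatives for images as well as the
  adjunction between images and inverse images.\<close>

lemma factorization_least:
  assumes "e \<in> E" "m \<in> M" "Cod C e = Dom C m" "n \<in> M"
  shows "factors_through C (m \<cdot> e) n \<longleftrightarrow> factors_through C m n"
proof
  assume fac: "factors_through C (m \<cdot> e) n"
  then obtain j where j: "j \<in> Hom C (Dom C e) (Dom C n)" "n \<cdot> j = m \<cdot> e"
    using Comp_Ar[of e m] assms by (auto simp: factors_through_def M_Ar E_Ar)
  have "m \<in> Hom C (Cod C e) (Cod C n)"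
    using Comp_Ar[of e m] factors_through_Cod[OF fac] assms by (simp add: Hom_iff M_Ar E_Ar)
  from diagonal[OF assms(1,4) j(1) this j(2)] assms(3)
  show "factors_through C m n"
    by (auto simp: factors_through_def)
next
  assume "factors_through C m n"
  then show "factors_through C (m \<cdot> e) n"
    using factors_through_trans_M[of "m \<cdot> e" m n] factors_through_Comp[of e m] assms
    by (simp add: M_Ar E_Ar)
qed

text \<open>Well-definedness of images: \<open>sub_image\<close> is a union over all representatives
  and all their factorizations, and every one of them contributes the same class.\<close>

lemma sub_image_cls:
  assumes f: "f \<in> Hom C X Y" and m: "m \<in> M" "Cod C m = X"
    and m': "m' \<in> M" "e \<in> E" "Cod C e = Dom C m'" "f \<cdot> m = m' \<cdot> e"
  shows "Cod C m' = Y" "sub_image C E M f (sub_iso C M X `` {m}) = sub_iso C M Y `` {m'}"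
proof -
  note Ar = M_Ar[OF m(1)] M_Ar[OF m'(1)] E_Ar[OF m'(2)]
  show Cod_m': "Cod C m' = Y"
    using f m m' Ar Comp_Ar[of m f] Comp_Ar[of e m'] by (auto simp: Hom_iff)
  have same: "sub_iso C M Y `` {k} = sub_iso C M Y `` {m'}"
    if n: "(m, n) \<in> sub_iso C M X" and k: "k \<in> M" "d \<in> E" "Cod C d = Dom C k" "f \<cdot> n = k \<cdot> d"
    for n k d
  proof -
    have nM: "n \<in> M" "Cod C n = X" and le: "factors_through C m n" "factors_through C n m"
      using n by (auto simp: sub_iso_iff)
    have Cod_k: "Cod C k = Y"
      using f nM k Comp_Ar[of n f] Comp_Ar[of d k] by (auto simp: Hom_iff M_Ar E_Ar)
    \<comment> \<open>Composing with \<open>f\<close> preserves factoring, so the two composites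
      factor through each other. By \<open>factorization_least\<close> the same then holds for their
      \<open>M\<close>-parts \<open>m'\<close> and \<open>k\<close>.\<close>
    have "factors_through C (m' \<cdot> e) (k \<cdot> d)" "factors_through C (k \<cdot> d) (m' \<cdot> e)"
      using le f m nM unfolding m'(4)[symmetric] k(4)[symmetric]
      by (auto simp: Hom_iff M_Ar intro: factors_through_Comp_left)
    then have "factors_through C (m' \<cdot> e) k" "factors_through C (k \<cdot> d) m'"
      using factors_through_trans_M[of "m' \<cdot> e" "k \<cdot> d" k] factors_through_Comp[of d k]
        factors_through_trans_M[of "k \<cdot> d" "m' \<cdot> e" m'] factors_through_Comp[of e m'] k m'
      by (simp_all add: M_Ar E_Ar)
    then show ?thesis
      using k m' Cod_k Cod_m' by (simp add: sub_cls_eq_iff factorization_least)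
  qed
  have Y: "Cod C f = Y"
    using f by (simp add: Hom_iff)
  show "sub_image C E M f (sub_iso C M X `` {m}) = sub_iso C M Y `` {m'}"
  proof
    show "sub_iso C M Y `` {m'} \<subseteq> sub_image C E M f (sub_iso C M X `` {m})"
      unfolding sub_image_def Y using m' sub_cls_self[OF m] by blast
    show "sub_image C E M f (sub_iso C M X `` {m}) \<subseteq> sub_iso C M Y `` {m'}"
      unfolding sub_image_def Y using same by blast
  qed
qed

lemma obtain_image:
  assumes "f \<in> Hom C X Y" "m \<in> M" "Cod C m = X"
  obtains m' e where "m' \<in> M" "e \<in> E" "Cod C e = Dom C m'" "f \<cdot> m = m' \<cdot> e" "Cod C m' = Y"
    "sub_image C E M f (sub_iso C M X `` {m}) = sub_iso C M Y `` {m'}"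
proof -
  have "f \<cdot> m \<in> Ar C"
    using assms Comp_Ar[of m f] by (auto simp: Hom_iff M_Ar)
  then obtain e m' where "m' \<in> M" "e \<in> E" "Cod C e = Dom C m'" "f \<cdot> m = m' \<cdot> e"
    using factorization by blast
  then show ?thesis
    using that sub_image_cls[OF assms] by blast
qed

lemma sub_image_in_carrier:
  assumes "f \<in> Hom C X Y" "P \<in> carrier (sub C M X)"
  shows "sub_image C E M f P \<in> carrier (sub C M Y)"
proof -
  obtain m where m: "m \<in> M" "Cod C m = X" "P = sub_iso C M X `` {m}"
    using assms(2) by (rule sub_carrierE)
  show ?thesis
    by (rule obtain_image[OF assms(1) m(1,2)]) (simp add: m(3) sub_cls_in_carrier)
qed

text \<open>Bounds on an image can be tested on \<open>f \<cdot> m\<close> itself, by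
  \<open>factorization_least\<close>. This is the image half of the adjunction with inverse
  images.\<close>

lemma sub_image_le_iff:
  assumes "f \<in> Hom C X Y" "m \<in> M" "Cod C m = X" "n \<in> M" "Cod C n = Y"
  shows "sub_image C E M f (sub_iso C M X `` {m}) \<sqsubseteq>\<^bsub>sub C M Y\<^esub> sub_iso C M Y `` {n} \<longleftrightarrow>
    factors_through C (f \<cdot> m) n"
  using assms(4,5)
  by (rule_tac obtain_image[OF assms(1-3)]) (simp add: sub_le_iff factorization_least)

end

section \<open>Inverse images and meets\<close>

context M_complete_category
begin

text \<open>The universal property with the second projection hidden: a factorization of
  \<open>f \<cdot> u\<close> through \<open>n\<close> is exactly the other leg of a cone with first
  leg \<open>u\<close>.\<close>

lemma pullback_factors_iff:
  assumes "is_pullback C f n p q" "u \<in> Hom C Z (Dom C f)"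
  shows "factors_through C u p \<longleftrightarrow> factors_through C (f \<cdot> u) n"
proof
  have p: "f \<in> Ar C" "n \<in> Ar C" "p \<in> Hom C (Dom C p) (Dom C f)" "q \<in> Hom C (Dom C p) (Dom C n)"
    "f \<cdot> p = n \<cdot> q"
    using assms(1) by (auto simp: is_pullback_def)
  {
    assume "factors_through C u p"
    then have "factors_through C (f \<cdot> u) (f \<cdot> p)"
      using factors_through_Comp_left[of u p f] p(1,3) by (simp add: Hom_iff)
    moreover have "factors_through C (f \<cdot> p) n"
      unfolding p(5) using p by (intro factors_through_Comp) (auto simp: Hom_iff)
    ultimately show "factors_through C (f \<cdot> u) n"
      using factors_through_trans[of "f \<cdot> u" "f \<cdot> p" n] p(2) by blast
  next
    assume "factors_through C (f \<cdot> u) n"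
    then obtain v where v: "v \<in> Hom C Z (Dom C n)" "n \<cdot> v = f \<cdot> u"
      using assms(2) p Comp_Ar[of u f] by (auto simp: factors_through_def Hom_iff)
    have "\<forall>Z. \<forall>u\<in>Hom C Z (Dom C f). \<forall>v\<in>Hom C Z (Dom C n). f \<cdot> u = n \<cdot> v \<longrightarrow>
        (\<exists>!h. h \<in> Hom C Z (Dom C p) \<and> p \<cdot> h = u \<and> q \<cdot> h = v)"
      using assms(1) unfolding is_pullback_def by (elim conjE)
    from this[rule_format, OF assms(2) v(1) v(2)[symmetric]]
    obtain h where "h \<in> Hom C Z (Dom C p)" "p \<cdot> h = u"
      by blast
    then show "factors_through C u p"
      using assms(2) by (auto simp: factors_through_def Hom_iff)
  }
qed

text \<open>Well-definedness of inverse images. By \<open>pullback_factors_iff\<close>, factoring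
  through a pullback of \<open>n\<close> depends only on which arrows factor through
  \<open>n\<close>, so equivalent \<open>n\<close> and \<open>n'\<close> have equivalent
  pullbacks.\<close>

lemma sub_preimage_cls:
  assumes f: "f \<in> Hom C X Y" and n: "n \<in> M" "Cod C n = Y"
    and p: "p \<in> M" "is_pullback C f n p q"
  shows "sub_preimage C M f (sub_iso C M Y `` {n}) = sub_iso C M X `` {p}"
proof -
  have Cod_p: "Cod C p = X"
    using p f by (auto simp: is_pullback_def Hom_iff)
  have same: "sub_iso C M X `` {p'} = sub_iso C M X `` {p}"
    if n': "(n, n') \<in> sub_iso C M Y" and p': "is_pullback C f n' p' q'" "p' \<in> M" for n' p' q'
  proof -
    have n'M: "n' \<in> M" and le: "factors_through C n n'" "factors_through C n' n"
      using n' by (auto simp: sub_iso_iff)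
    have Cod_p': "Cod C p' = X"
      using p' f by (auto simp: is_pullback_def Hom_iff)
    have hom: "p \<in> Hom C (Dom C p) (Dom C f)" "p' \<in> Hom C (Dom C p') (Dom C f)"
      using p p' by (auto simp: is_pullback_def)
    have "factors_through C (f \<cdot> p) n" "factors_through C (f \<cdot> p') n'"
      using pullback_factors_iff[OF p(2) hom(1)] pullback_factors_iff[OF p'(1) hom(2)] p p'
      by (auto simp: factors_through_refl M_Ar)
    then have "factors_through C (f \<cdot> p) n'" "factors_through C (f \<cdot> p') n"
      using le n n'M factors_through_trans_M[of "f \<cdot> p" n n']
        factors_through_trans_M[of "f \<cdot> p'" n' n]
      by simp_all
    then have "factors_through C p p'" "factors_through C p' p"
      using pullback_factors_iff[OF p'(1) hom(1)] pullback_factors_iff[OF p(2) hom(2)] by auto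
    then show ?thesis
      using p p' Cod_p Cod_p' by (simp add: sub_cls_eq_iff)
  qed
  have X: "Dom C f = X"
    using f by (simp add: Hom_iff)
  show ?thesis
  proof
    show "sub_iso C M X `` {p} \<subseteq> sub_preimage C M f (sub_iso C M Y `` {n})"
      unfolding sub_preimage_def X using p(2) sub_cls_self[OF n] by blast
    show "sub_preimage C M f (sub_iso C M Y `` {n}) \<subseteq> sub_iso C M X `` {p}"
    proof
      fix r assume "r \<in> sub_preimage C M f (sub_iso C M Y `` {n})"
      then obtain n' p' q' where *: "(n, n') \<in> sub_iso C M Y" "is_pullback C f n' p' q'"
        "(p', r) \<in> sub_iso C M X"
        unfolding sub_preimage_def X by blast
      \<comment> \<open>The union defining \<open>sub_preimage\<close> does not ask
        \<open>p'\<close> to be in \<open>M\<close>. But \<open>sub_iso\<close> relates only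
        \<open>M\<close>-morphisms, so the member \<open>r\<close> of its class supplies
        this.\<close>
      then have "p' \<in> M"
        by (simp add: sub_iso_iff)
      with * same show "r \<in> sub_iso C M X `` {p}"
        by blast
    qed
  qed
qed

text \<open>Both inequalities in the second claim say that \<open>f \<cdot> m\<close> factors
  through \<open>n\<close>, on one side by the pullback property and on the other by
  \<open>sub_image_le_iff\<close>.\<close>

lemma sub_preimage_adjoint:
  assumes f: "f \<in> Hom C X Y" and P: "P \<in> carrier (sub C M X)" and Q: "Q \<in> carrier (sub C M Y)"
  shows "sub_preimage C M f Q \<in> carrier (sub C M X)"
    and "P \<sqsubseteq>\<^bsub>sub C M X\<^esub> sub_preimage C M f Q \<longleftrightarrow> sub_image C E M f P \<sqsubseteq>\<^bsub>sub C M Y\<^esub> Q"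
proof -
  obtain m where m: "m \<in> M" "Cod C m = X" "P = sub_iso C M X `` {m}"
    using P by (rule sub_carrierE)
  obtain n where n: "n \<in> M" "Cod C n = Y" "Q = sub_iso C M Y `` {n}"
    using Q by (rule sub_carrierE)
  obtain p q where p: "p \<in> M" "is_pullback C f n p q"
    using M_pullback[of n f] f n by (auto simp: Hom_iff)
  have pre: "sub_preimage C M f Q = sub_iso C M X `` {p}"
    using sub_preimage_cls[OF f n(1,2) p] n by simp
  have Cod_p: "Cod C p = X"
    using p f by (auto simp: is_pullback_def Hom_iff)
  have "m \<in> Hom C (Dom C m) (Dom C f)"
    using m f by (auto simp: Hom_iff M_Ar)
  from pullback_factors_iff[OF p(2) this]
  show "P \<sqsubseteq>\<^bsub>sub C M X\<^esub> sub_preimage C M f Q \<longleftrightarrow> sub_image C E M f P \<sqsubseteq>\<^bsub>sub C M Y\<^esub> Q"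
    unfolding pre using m n p f Cod_p by (simp add: sub_le_iff sub_image_le_iff)
  show "sub_preimage C M f Q \<in> carrier (sub C M X)"
    unfolding pre using p(1) Cod_p by (rule sub_cls_in_carrier)
qed

text \<open>Shows that the lattice meet, defined by choice, really is an infimum: the intersection
  of all representatives of members of \<open>N\<close> provides one. The case \<open>N = {}\<close>
  is included and gives the top subobject.\<close>

lemma sub_meet_greatest:
  assumes X: "X \<in> Ob C" and N: "N \<subseteq> carrier (sub C M X)"
  shows "greatest (sub C M X) (\<Sqinter>\<^bsub>sub C M X\<^esub> N) (Lower (sub C M X) N)"
proof -
  define K where "K = {k \<in> M. Cod C k = X \<and> sub_iso C M X `` {k} \<in> N}"
  obtain m where m: "m \<in> M" "is_intersection C X K m"
    using M_intersection[OF X, of K] by (auto simp: K_def)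
  have Cod_m: "Cod C m = X"
    using m by (auto simp: is_intersection_def)
  have "greatest (sub C M X) (sub_iso C M X `` {m}) (Lower (sub C M X) N)"
    unfolding greatest_def
  proof (intro conjI ballI)
    show "Lower (sub C M X) N \<subseteq> carrier (sub C M X)"
      by (auto simp: Lower_def)
    have "sub_iso C M X `` {m} \<sqsubseteq>\<^bsub>sub C M X\<^esub> P" if P: "P \<in> N" for P
    proof -
      obtain k where k: "k \<in> M" "Cod C k = X" "P = sub_iso C M X `` {k}"
        using N P by (blast elim: sub_carrierE)
      then have "k \<in> K"
        using P by (simp add: K_def)
      then show ?thesis
        using m k Cod_m by (auto simp: sub_le_iff is_intersection_def)
    qed
    then show "sub_iso C M X `` {m} \<in> Lower (sub C M X) N"
      using sub_cls_in_carrier[OF m(1) Cod_m] by (auto simp: Lower_def)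
    fix Q assume Q: "Q \<in> Lower (sub C M X) N"
    then have "Q \<in> carrier (sub C M X)"
      by (auto simp: Lower_def)
    then obtain l where l: "l \<in> M" "Cod C l = X" "Q = sub_iso C M X `` {l}"
      by (rule sub_carrierE)
    \<comment> \<open>A lower bound of \<open>N\<close> is represented by a cone over
      \<open>K\<close>, to which the universal property of the intersection applies.\<close>
    have "factors_through C l k" if "k \<in> K" for k
    proof -
      have "sub_iso C M X `` {k} \<in> N" "k \<in> M" "Cod C k = X"
        using that by (auto simp: K_def)
      then have "Q \<sqsubseteq>\<^bsub>sub C M X\<^esub> sub_iso C M X `` {k}"
        using Q N by (auto simp: Lower_def)
      then show ?thesis
        using l \<open>k \<in> M\<close> \<open>Cod C k = X\<close> by (simp add: sub_le_iff)
    qed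
    then have "\<exists>!h. h \<in> Hom C (Dom C l) (Dom C m) \<and> m \<cdot> h = l"
      using m(2) l M_Ar[OF l(1)] unfolding is_intersection_def by blast
    then have "factors_through C l m"
      by (auto simp: factors_through_def)
    then show "Q \<sqsubseteq>\<^bsub>sub C M X\<^esub> sub_iso C M X `` {m}"
      using l m Cod_m by (simp add: sub_le_iff)
  qed
  \<comment> \<open>The meet is a Hilbert choice among greatest lower bounds, so exhibiting one
    suffices.\<close>
  then show ?thesis
    unfolding inf_def by (rule someI)
qed

section \<open>The closure operator of a meet-preserving topogenous order\<close>

context
  fixes R :: "'o \<Rightarrow> 'a set \<Rightarrow> 'a set \<Rightarrow> bool"
  assumes R_topogenous: "topogenous_order C M R"
    and R_Meet: "Meet_preserving C M R"
begin

lemma topogenous_in_carrier: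
  assumes "X \<in> Ob C" "R X P Q"
  shows "Q \<in> carrier (sub C M X)"
  using R_topogenous assms unfolding topogenous_order_def by blast

lemma topogenous_closure_in_carrier:
  assumes "X \<in> Ob C"
  shows "topogenous_closure C M R X P \<in> carrier (sub C M X)"
  using sub_meet_greatest[OF assms, of "{p \<in> carrier (sub C M X). R X P p}"]
  by (auto simp: topogenous_closure_def greatest_def Lower_def)

lemma topogenous_closure_least:
  assumes "X \<in> Ob C" "R X P Q"
  shows "topogenous_closure C M R X P \<sqsubseteq>\<^bsub>sub C M X\<^esub> Q"
proof -
  have "Q \<in> carrier (sub C M X)"
    using topogenous_in_carrier assms by blast
  then show ?thesis
    using sub_meet_greatest[OF assms(1), of "{p \<in> carrier (sub C M X). R X P p}"] assms(2)
    by (auto simp: topogenous_closure_def greatest_def Lower_def)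
qed

text \<open>Meet preservation is applied to the very family whose meet defines the closure. Together
  with \<open>topogenous_closure_least\<close>, the closure of \<open>P\<close> is the least
  subobject \<open>Q\<close> with \<open>R X P Q\<close>.\<close>

lemma topogenous_closure_rel:
  assumes "X \<in> Ob C" "P \<in> carrier (sub C M X)"
  shows "R X P (topogenous_closure C M R X P)"
  using R_Meet assms by (auto simp: Meet_preserving_def topogenous_closure_def)

lemma topogenous_le:
  assumes "X \<in> Ob C" "R X P Q"
  shows "P \<sqsubseteq>\<^bsub>sub C M X\<^esub> Q"
  using R_topogenous assms unfolding topogenous_order_def by blast

lemma topogenous_mono:
  assumes "X \<in> Ob C" "P \<in> carrier (sub C M X)" "P \<sqsubseteq>\<^bsub>sub C M X\<^esub> Q" "R X Q W"
  shows "R X P W"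
proof -
  have "W \<in> carrier (sub C M X)"
    using topogenous_in_carrier assms by blast
  with R_topogenous assms sub_le_refl[OF this] show ?thesis
    unfolding topogenous_order_def by blast
qed

text \<open>(C1) is (T1) for the pair of \<open>P\<close> and its closure. For (C2), if
  \<open>P \<le> Q\<close> then by (T2) the closure of \<open>Q\<close> is also an
  \<open>R\<close>-successor of \<open>P\<close>, hence above the least one.\<close>

lemma topogenous_closure_operator: "closure_operator C E M (topogenous_closure C M R)"
  unfolding closure_operator_def
proof (intro conjI ballI impI)
  fix X assume X: "X \<in> Ob C"
  show "topogenous_closure C M R X \<in> carrier (sub C M X) \<rightarrow> carrier (sub C M X)"
    using topogenous_closure_in_carrier[OF X] by auto
  fix P assume P: "P \<in> carrier (sub C M X)"
  show "P \<sqsubseteq>\<^bsub>sub C M X\<^esub> topogenous_closure C M R X P"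
    using topogenous_le[OF X topogenous_closure_rel[OF X P]] .
  show "topogenous_closure C M R X P \<sqsubseteq>\<^bsub>sub C M X\<^esub> topogenous_closure C M R X Q"
    if "Q \<in> carrier (sub C M X)" "P \<sqsubseteq>\<^bsub>sub C M X\<^esub> Q" for Q
    using topogenous_closure_least[OF X topogenous_mono[OF X P that(2)]]
      topogenous_closure_rel[OF X that(1)] by blast
  fix Y f assume Y: "Y \<in> Ob C" and f: "f \<in> Hom C X Y"
  let ?fP = "sub_image C E M f P" and ?c = "topogenous_closure C M R"
  have fP: "?fP \<in> carrier (sub C M Y)"
    using f P by (rule sub_image_in_carrier)
  \<comment> \<open>(T3) pulls the relation between \<open>?fP\<close> and its closure back along
    \<open>f\<close>. The unit of the adjunction and (T2) then replace the left side by
    \<open>P\<close>, and leastness bounds \<open>?c X P\<close>. Transposing back gives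
    (C3).\<close>
  have "R X (sub_preimage C M f ?fP) (sub_preimage C M f (?c Y ?fP))"
    using R_topogenous topogenous_closure_rel[OF Y fP] X Y f
    unfolding topogenous_order_def by blast
  moreover have "P \<sqsubseteq>\<^bsub>sub C M X\<^esub> sub_preimage C M f ?fP"
    using sub_preimage_adjoint(2)[OF f P fP] sub_le_refl[OF fP] by simp
  ultimately have "?c X P \<sqsubseteq>\<^bsub>sub C M X\<^esub> sub_preimage C M f (?c Y ?fP)"
    using topogenous_closure_least[OF X topogenous_mono[OF X P]] by blast
  then show "sub_image C E M f (?c X P) \<sqsubseteq>\<^bsub>sub C M Y\<^esub> ?c Y ?fP"
    using sub_preimage_adjoint(2)[OF f] topogenous_closure_in_carrier X Y by blast
qed

lemma topogenous_closure_idempotent: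
  assumes "interpolative C M R"
  shows "idempotent_closure C M (topogenous_closure C M R)"
  unfolding idempotent_closure_def
proof (intro ballI)
  fix X P assume X: "X \<in> Ob C" and P: "P \<in> carrier (sub C M X)"
  let ?c = "topogenous_closure C M R X"
  have c: "?c Q \<in> carrier (sub C M X)" for Q
    by (rule topogenous_closure_in_carrier[OF X])
  obtain p where p: "p \<in> carrier (sub C M X)" "R X P p" "R X p (?c P)"
    using assms X topogenous_closure_rel[OF X P] unfolding interpolative_def by blast
  \<comment> \<open>The interpolant is squeezed: \<open>?c P \<le> p\<close> by leastness and
    \<open>p \<le> ?c P\<close> by (T1). Hence \<open>?c P\<close> is related to itself.\<close>
  have "p = ?c P"
    using sub_le_antisym[OF p(1) c] topogenous_le[OF X p(3)]
      topogenous_closure_least[OF X p(2)] by blast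
  then have "?c (?c P) \<sqsubseteq>\<^bsub>sub C M X\<^esub> ?c P"
    using topogenous_closure_least[OF X] p(3) by simp
  moreover have "?c P \<sqsubseteq>\<^bsub>sub C M X\<^esub> ?c (?c P)"
    using topogenous_le[OF X topogenous_closure_rel[OF X c]] .
  ultimately show "?c (?c P) = ?c P"
    using sub_le_antisym c by blast
qed

end

end

section \<open>Lifting along a faithful fibration\<close>

locale lifted_factorization =
  proper_factorization_system C E M + faithful_M_fibration A C M Fo Fa
  for A :: "('p, 'b) cat" and C :: "('o, 'a) cat" and E M :: "'a set"
    and Fo :: "'p \<Rightarrow> 'o" and Fa :: "'b \<Rightarrow> 'a"
begin

abbreviation "EA \<equiv> E_lift A E Fa"
abbreviation "MA \<equiv> M_lift A C M Fo Fa"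

lemma Fa_Ar:
  assumes "f \<in> Ar A"
  shows "Fa f \<in> Ar C" "Dom C (Fa f) = Fo (Dom A f)" "Cod C (Fa f) = Fo (Cod A f)"
  using Fa_in_Hom[of f "Dom A f" "Cod A f"] assms by (auto simp: Hom_iff)

lemma Fa_Comp_Ar:
  assumes "f \<in> Ar A" "g \<in> Ar A" "Cod A f = Dom A g"
  shows "Fa (g \<cdot>\<^bsub>A\<^esub> f) = Fa g \<cdot>\<^bsub>C\<^esub> Fa f"
  using assms by (intro Fa_Comp) (auto simp: Hom_iff)

lemma Ini_lift:
  assumes "m \<in> Ini A C Fo Fa" "h \<in> Hom A Z (Cod A m)"
    and "u \<in> Hom C (Fo Z) (Fo (Dom A m))" "Fa m \<cdot>\<^bsub>C\<^esub> u = Fa h"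
  obtains v where "v \<in> Hom A Z (Dom A m)" "Fa v = u" "m \<cdot>\<^bsub>A\<^esub> v = h"
proof -
  have "Z \<in> Ob A"
    using assms(2) A.Dom_in_Ob by (auto simp: Hom_iff)
  then show ?thesis
    using assms that unfolding Ini_def by blast
qed

lemma Fa_iso:
  assumes "iso_arr A h"
  shows "iso_arr C (Fa h)"
proof -
  obtain k where hk: "h \<in> Ar A" "k \<in> Hom A (Cod A h) (Dom A h)"
    "k \<cdot>\<^bsub>A\<^esub> h = Ide A (Dom A h)" "h \<cdot>\<^bsub>A\<^esub> k = Ide A (Cod A h)"
    using assms by (auto simp: iso_arr_def)
  then have "Fa k \<cdot>\<^bsub>C\<^esub> Fa h = Ide C (Fo (Dom A h))" "Fa h \<cdot>\<^bsub>C\<^esub> Fa k = Ide C (Fo (Cod A h))"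
    using Fa_Comp_Ar[of h k] Fa_Comp_Ar[of k h]
    by (auto simp: Hom_iff Fa_Ide A.Dom_in_Ob A.Cod_in_Ob)
  then show ?thesis
    using hk Fa_in_Hom[OF hk(2)] Fa_Ar[OF hk(1)] by (auto simp: iso_arr_def)
qed

text \<open>Makes \<open>MA\<close> closed under composition with isomorphisms. To lift
  \<open>u\<close> along \<open>m \<cdot> h\<close>, lift \<open>Fa h \<cdot> u\<close> along
  \<open>m\<close> to \<open>v\<close> and compose \<open>v\<close> with the inverse
  \<open>k\<close> of \<open>h\<close>.\<close>

lemma Ini_Comp_iso:
  assumes m: "m \<in> Ini A C Fo Fa" and h: "iso_arr A h" "Cod A h = Dom A m"
  shows "m \<cdot>\<^bsub>A\<^esub> h \<in> Ini A C Fo Fa"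
proof -
  have mAr: "m \<in> Ar A"
    using m by (simp add: Ini_def)
  obtain k where hk: "h \<in> Ar A" "k \<in> Hom A (Dom A m) (Dom A h)"
    "k \<cdot>\<^bsub>A\<^esub> h = Ide A (Dom A h)" "h \<cdot>\<^bsub>A\<^esub> k = Ide A (Dom A m)"
    using h by (auto simp: iso_arr_def)
  note mh = A.Comp_Ar[OF hk(1) mAr h(2)]
  have "\<exists>v. v \<in> Hom A Z (Dom A (m \<cdot>\<^bsub>A\<^esub> h)) \<and> Fa v = u \<and> (m \<cdot>\<^bsub>A\<^esub> h) \<cdot>\<^bsub>A\<^esub> v = z"
    if Z: "Z \<in> Ob A" and z: "z \<in> Hom A Z (Cod A (m \<cdot>\<^bsub>A\<^esub> h))"
      and u: "u \<in> Hom C (Fo Z) (Fo (Dom A (m \<cdot>\<^bsub>A\<^esub> h)))" "Fa (m \<cdot>\<^bsub>A\<^esub> h) \<cdot>\<^bsub>C\<^esub> u = Fa z" for Z z u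
  proof -
    have u': "u \<in> Hom C (Fo Z) (Fo (Dom A h))"
      using u mh by simp
    have z': "z \<in> Hom A Z (Cod A m)"
      using z mh by simp
    have "Fa m \<cdot>\<^bsub>C\<^esub> (Fa h \<cdot>\<^bsub>C\<^esub> u) = Fa z"
      using u' u(2) Fa_Comp_Ar[OF hk(1) mAr h(2)] Comp_assoc_Ar[of u "Fa h" "Fa m"] h
      by (auto simp: Hom_iff Fa_Ar hk(1) mAr)
    moreover have "Fa h \<cdot>\<^bsub>C\<^esub> u \<in> Hom C (Fo Z) (Fo (Dom A m))"
      using u' h by (intro Comp_in_Hom) (auto simp: Hom_iff Fa_Ar hk(1))
    ultimately obtain v where v: "v \<in> Hom A Z (Dom A m)" "Fa v = Fa h \<cdot>\<^bsub>C\<^esub> u" "m \<cdot>\<^bsub>A\<^esub> v = z"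
      using Ini_lift[OF m z'] by blast
    have kv: "k \<cdot>\<^bsub>A\<^esub> v \<in> Hom A Z (Dom A h)"
      using A.Comp_in_Hom[OF v(1) hk(2)] .
    have "Fa k \<cdot>\<^bsub>C\<^esub> Fa h = Ide C (Fo (Dom A h))"
      using hk h Fa_Comp_Ar[of h k] by (auto simp: Hom_iff Fa_Ide A.Dom_in_Ob)
    then have "Fa (k \<cdot>\<^bsub>A\<^esub> v) = u"
      using v hk h u' Fa_Comp_Ar[of v k] Comp_assoc_Ar[of u "Fa h" "Fa k"]
      by (auto simp: Hom_iff Fa_Ar Ide_Comp_Ar)
    moreover have "h \<cdot>\<^bsub>A\<^esub> (k \<cdot>\<^bsub>A\<^esub> v) = v"
      using A.Comp_assoc_Ar[of v k h] v hk h by (auto simp: Hom_iff A.Ide_Comp_Ar)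
    then have "(m \<cdot>\<^bsub>A\<^esub> h) \<cdot>\<^bsub>A\<^esub> (k \<cdot>\<^bsub>A\<^esub> v) = z"
      using A.Comp_assoc_Ar[of "k \<cdot>\<^bsub>A\<^esub> v" h m] kv hk mAr h v by (auto simp: Hom_iff)
    ultimately show ?thesis
      using kv mh by auto
  qed
  \<comment> \<open>Uniqueness of the lift comes from faithfulness, since any two candidates have
    the same image \<open>u\<close>.\<close>
  then show ?thesis
    unfolding Ini_def using mh(1) by (auto intro: faithful)
qed

lemma M_lift_D:
  assumes "m \<in> MA"
  shows "m \<in> Ar A" "Fa m \<in> M" "m \<in> Ini A C Fo Fa"
  using assms by (auto simp: M_lift_def)

lemma M_lift_I: "m \<in> Ini A C Fo Fa \<Longrightarrow> Fa m \<in> M \<Longrightarrow> m \<in> MA"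
  by (auto simp: M_lift_def Ini_def)

text \<open>A faithful functor reflects monomorphisms; \<open>lift_epi\<close> is the dual
  fact.\<close>

lemma lift_mono:
  assumes "m \<in> MA"
  shows "mono_arr A m"
  unfolding mono_arr_def
proof (intro conjI allI ballI impI)
  note m = M_lift_D[OF assms]
  show "m \<in> Ar A" by (fact m)
  fix Z f g assume fg: "f \<in> Hom A Z (Dom A m)" "g \<in> Hom A Z (Dom A m)" "m \<cdot>\<^bsub>A\<^esub> f = m \<cdot>\<^bsub>A\<^esub> g"
  have "Fa m \<cdot>\<^bsub>C\<^esub> Fa f = Fa m \<cdot>\<^bsub>C\<^esub> Fa g"
    using fg m Fa_Comp_Ar[of f m] Fa_Comp_Ar[of g m] by (auto simp: Hom_iff)
  moreover have "Fa f \<in> Hom C (Fo Z) (Dom C (Fa m))" "Fa g \<in> Hom C (Fo Z) (Dom C (Fa m))"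
    using fg Fa_in_Hom by (auto simp: Fa_Ar m)
  ultimately have "Fa f = Fa g"
    using M_mono[OF m(2)] unfolding mono_arr_def by blast
  then show "f = g"
    using faithful fg by blast
qed

lemma lift_epi:
  assumes "e \<in> EA"
  shows "epi_arr A e"
  unfolding epi_arr_def
proof (intro conjI allI ballI impI)
  have e: "e \<in> Ar A" "Fa e \<in> E"
    using assms by (auto simp: E_lift_def)
  show "e \<in> Ar A" by (fact e)
  fix Z f g assume fg: "f \<in> Hom A (Cod A e) Z" "g \<in> Hom A (Cod A e) Z" "f \<cdot>\<^bsub>A\<^esub> e = g \<cdot>\<^bsub>A\<^esub> e"
  have "Fa f \<cdot>\<^bsub>C\<^esub> Fa e = Fa g \<cdot>\<^bsub>C\<^esub> Fa e"
    using fg e Fa_Comp_Ar[of e f] Fa_Comp_Ar[of e g] by (auto simp: Hom_iff)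
  moreover have "Fa f \<in> Hom C (Cod C (Fa e)) (Fo Z)" "Fa g \<in> Hom C (Cod C (Fa e)) (Fo Z)"
    using fg Fa_in_Hom by (auto simp: Fa_Ar e)
  ultimately have "Fa f = Fa g"
    using E_epi[OF e(2)] unfolding epi_arr_def by blast
  then show "f = g"
    using faithful fg by blast
qed

text \<open>Factor \<open>Fa f\<close> in \<open>C\<close> and lift the \<open>M\<close>-part
  initially over the codomain of \<open>f\<close>. Initiality of this lift, tested against
  \<open>f\<close>, then lifts the \<open>E\<close>-part.\<close>

lemma lift_factorization:
  assumes f: "f \<in> Ar A"
  shows "\<exists>e\<in>EA. \<exists>m\<in>MA. Cod A e = Dom A m \<and> f = m \<cdot>\<^bsub>A\<^esub> e"
proof -
  obtain e m where em: "e \<in> E" "m \<in> M" "Cod C e = Dom C m" "Fa f = m \<cdot>\<^bsub>C\<^esub> e"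
    using factorization Fa_Ar[OF f] by blast
  have Dom_Cod: "Cod C m = Fo (Cod A f)" "Dom C e = Fo (Dom A f)"
    using Comp_Ar[of e m] em Fa_Ar[OF f] by (auto simp: E_Ar M_Ar)
  obtain m' where m': "m' \<in> Ini A C Fo Fa" "Cod A m' = Cod A f" "Fa m' = m"
    using initial_lifting[OF _ em(2) Dom_Cod(1)] A.Cod_in_Ob[OF f] by blast
  have "m' \<in> Ar A"
    using m' by (simp add: Ini_def)
  then have "e \<in> Hom C (Fo (Dom A f)) (Fo (Dom A m'))"
    using em Dom_Cod Fa_Ar[of m'] m' by (auto simp: Hom_iff E_Ar)
  moreover have "f \<in> Hom A (Dom A f) (Cod A m')"
    using f m' by (simp add: Hom_iff)
  ultimately obtain v where v: "v \<in> Hom A (Dom A f) (Dom A m')" "Fa v = e" "m' \<cdot>\<^bsub>A\<^esub> v = f"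
    using Ini_lift[OF m'(1)] em(4) m'(3) by metis
  have "v \<in> EA" "m' \<in> MA"
    using v em m' by (auto simp: E_lift_def Hom_iff intro: M_lift_I)
  with v show ?thesis
    by (auto simp: Hom_iff)
qed

lemma lift_diagonal:
  assumes e: "e \<in> EA" and m: "m \<in> MA"
    and u: "u \<in> Hom A (Dom A e) (Dom A m)" and v: "v \<in> Hom A (Cod A e) (Cod A m)"
    and sq: "m \<cdot>\<^bsub>A\<^esub> u = v \<cdot>\<^bsub>A\<^esub> e"
  shows "\<exists>!d. d \<in> Hom A (Cod A e) (Dom A m) \<and> d \<cdot>\<^bsub>A\<^esub> e = u \<and> m \<cdot>\<^bsub>A\<^esub> d = v"
proof -
  have e': "e \<in> Ar A" "Fa e \<in> E"
    using e by (auto simp: E_lift_def)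
  note m' = M_lift_D[OF m]
  have "Fa m \<cdot>\<^bsub>C\<^esub> Fa u = Fa v \<cdot>\<^bsub>C\<^esub> Fa e"
    using sq Fa_Comp_Ar[of u m] Fa_Comp_Ar[of e v] u v e' m' by (auto simp: Hom_iff)
  moreover have "Fa u \<in> Hom C (Dom C (Fa e)) (Dom C (Fa m))"
    "Fa v \<in> Hom C (Cod C (Fa e)) (Cod C (Fa m))"
    using Fa_in_Hom[OF u] Fa_in_Hom[OF v] by (simp_all add: Fa_Ar e' m')
  ultimately obtain d where d: "d \<in> Hom C (Cod C (Fa e)) (Dom C (Fa m))"
    "d \<cdot>\<^bsub>C\<^esub> Fa e = Fa u" "Fa m \<cdot>\<^bsub>C\<^esub> d = Fa v"
    using diagonal[OF e'(2) m'(2)] by blast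
  have "d \<in> Hom C (Fo (Cod A e)) (Fo (Dom A m))"
    using d(1) by (simp add: Fa_Ar e' m')
  then obtain d' where d': "d' \<in> Hom A (Cod A e) (Dom A m)" "Fa d' = d" "m \<cdot>\<^bsub>A\<^esub> d' = v"
    using Ini_lift[OF m'(3) v _ d(3)] by blast
  have eHom: "e \<in> Hom A (Dom A e) (Cod A e)"
    using e' by (simp add: Hom_iff)
  \<comment> \<open>Lifting \<open>d\<close> along the initial \<open>m\<close> secures only the
    triangle with \<open>v\<close>; the triangle with \<open>u\<close> holds after applying
    \<open>Fa\<close> and is reflected by faithfulness. Uniqueness follows as \<open>m\<close> is
    monic.\<close>
  have "d' \<cdot>\<^bsub>A\<^esub> e = u"
    using A.Comp_in_Hom[OF eHom d'(1)] u by (rule faithful) (simp add: Fa_Comp[OF eHom d'(1)] d' d)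
  then show ?thesis
    using d' lift_mono[OF m] unfolding mono_arr_def by blast
qed

end

text \<open>Makes the results on subobjects, their order and images available in \<open>A\<close>
  under the prefix \<open>lift\<close>.\<close>

sublocale lifted_factorization \<subseteq> lift: proper_factorization_system A EA MA
proof
  show "epi_arr A e" if "e \<in> EA" for e
    using that by (rule lift_epi)
  show "mono_arr A m" if "m \<in> MA" for m
    using that by (rule lift_mono)
  show "h \<cdot>\<^bsub>A\<^esub> e \<in> EA" if "e \<in> EA" "iso_arr A h" "Dom A h = Cod A e" for e h
  proof -
    have "e \<in> Ar A" "Fa e \<in> E" "h \<in> Ar A"
      using that by (auto simp: E_lift_def iso_arr_def)
    then show ?thesis
      using that iso_Comp_E[of "Fa e" "Fa h"] Fa_iso[of h] A.Comp_Ar[of e h] Fa_Comp_Ar[of e h]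
      by (auto simp: E_lift_def Fa_Ar)
  qed
  show "m \<cdot>\<^bsub>A\<^esub> h \<in> MA" if "m \<in> MA" "iso_arr A h" "Cod A h = Dom A m" for m h
  proof -
    note m = M_lift_D[OF that(1)]
    have "h \<in> Ar A"
      using that by (auto simp: iso_arr_def)
    then have "Fa (m \<cdot>\<^bsub>A\<^esub> h) \<in> M"
      using that m M_Comp_iso[of "Fa m" "Fa h"] Fa_iso[of h] Fa_Comp_Ar[of h m]
      by (auto simp: Fa_Ar)
    then show ?thesis
      using M_lift_I Ini_Comp_iso[OF m(3) that(2,3)] by blast
  qed
qed (fact lift_factorization lift_diagonal)+

section \<open>The maps \<gamma> and \<delta>, and the transfer of closure operators\<close>

context lifted_factorization
begin

lemma M_lift_Cod: "m \<in> MA \<Longrightarrow> Cod A m = X \<Longrightarrow> Cod C (Fa m) = Fo X"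
  using M_lift_D Fa_Ar by auto

text \<open>Initiality of \<open>n\<close> lifts a factorization from \<open>C\<close> to
  \<open>A\<close>. This is why \<gamma> reflects the order of subobjects as well as preserving
  it.\<close>

lemma factors_through_Fa_iff:
  assumes "m \<in> Ar A" "n \<in> MA" "Cod A m = Cod A n"
  shows "factors_through C (Fa m) (Fa n) \<longleftrightarrow> factors_through A m n"
proof
  note n = M_lift_D[OF assms(2)]
  {
    assume "factors_through C (Fa m) (Fa n)"
    then obtain j where j: "j \<in> Hom C (Fo (Dom A m)) (Fo (Dom A n))" "Fa n \<cdot>\<^bsub>C\<^esub> j = Fa m"
      using assms n by (auto simp: factors_through_def Fa_Ar)
    have "m \<in> Hom A (Dom A m) (Cod A n)"
      using assms by (simp add: Hom_iff)
    from Ini_lift[OF n(3) this j] show "factors_through A m n"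
      unfolding factors_through_def by blast
  next
    assume "factors_through A m n"
    then obtain j where j: "j \<in> Hom A (Dom A m) (Dom A n)" "n \<cdot>\<^bsub>A\<^esub> j = m"
      by (auto simp: factors_through_def)
    then have "Fa n \<cdot>\<^bsub>C\<^esub> Fa j = Fa m"
      using Fa_Comp_Ar[of j n] n by (auto simp: Hom_iff)
    then show "factors_through C (Fa m) (Fa n)"
      using Fa_in_Hom[OF j(1)] n assms by (auto simp: factors_through_def Fa_Ar)
  }
qed

lemma sub_gamma_cls:
  assumes m: "m \<in> MA" "Cod A m = X"
  shows "sub_gamma C M Fo Fa X (sub_iso A MA X `` {m}) = sub_iso C M (Fo X) `` {Fa m}"
proof -
  have "sub_iso C M (Fo X) `` {Fa n} = sub_iso C M (Fo X) `` {Fa m}"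
    if "(m, n) \<in> sub_iso A MA X" for n
  proof -
    have n: "n \<in> MA" "Cod A n = X" "factors_through A m n" "factors_through A n m"
      using that by (auto simp: lift.sub_iso_iff)
    then show ?thesis
      using m M_lift_D M_lift_Cod by (simp add: sub_cls_eq_iff factors_through_Fa_iff)
  qed
  then show ?thesis
    unfolding sub_gamma_def using lift.sub_cls_self[OF m] by blast
qed

text \<open>Well-definedness of \<delta>: initial lifts of equivalent representatives factor through
  each other by \<open>factors_through_Fa_iff\<close>. The lift \<open>p\<close> lies over
  \<open>n\<close> on the nose, which later gives \<gamma> \<circ> \<delta> = id.\<close>

lemma obtain_lift:
  assumes "X \<in> Ob A" "n \<in> M" "Cod C n = Fo X"
  obtains p where "p \<in> MA" "Cod A p = X" "Fa p = n"
    "sub_delta A C M Fo Fa X (sub_iso C M (Fo X) `` {n}) = sub_iso A MA X `` {p}"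
proof -
  obtain p where p: "p \<in> Ini A C Fo Fa" "Cod A p = X" "Fa p = n"
    using initial_lifting[OF assms] by blast
  have pM: "p \<in> MA"
    using p assms by (auto intro: M_lift_I)
  have same: "sub_iso A MA X `` {q} = sub_iso A MA X `` {p}"
    if "(n, Fa q) \<in> sub_iso C M (Fo X)" "q \<in> Ini A C Fo Fa" "Cod A q = X" for q
  proof -
    have q: "Fa q \<in> M" "factors_through C n (Fa q)" "factors_through C (Fa q) n"
      using that by (auto simp: sub_iso_iff)
    then have "q \<in> MA"
      using that by (auto intro: M_lift_I)
    then show ?thesis
      using q that p pM factors_through_Fa_iff[of q p] factors_through_Fa_iff[of p q] M_lift_D
      by (simp add: lift.sub_cls_eq_iff)
  qed
  have "sub_delta A C M Fo Fa X (sub_iso C M (Fo X) `` {n}) = sub_iso A MA X `` {p}"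
    unfolding sub_delta_def using same p sub_cls_self[OF assms(2,3)] by blast
  with p pM that show ?thesis
    by blast
qed

lemma sub_gamma_in_carrier:
  "P \<in> carrier (sub A MA X) \<Longrightarrow> sub_gamma C M Fo Fa X P \<in> carrier (sub C M (Fo X))"
  by (elim lift.sub_carrierE) (simp add: sub_gamma_cls sub_cls_in_carrier M_lift_D M_lift_Cod)

lemma sub_gamma_mono:
  assumes "P \<in> carrier (sub A MA X)" "Q \<in> carrier (sub A MA X)" "P \<sqsubseteq>\<^bsub>sub A MA X\<^esub> Q"
  shows "sub_gamma C M Fo Fa X P \<sqsubseteq>\<^bsub>sub C M (Fo X)\<^esub> sub_gamma C M Fo Fa X Q"
  using assms
  by (elim lift.sub_carrierE)
    (simp add: sub_gamma_cls sub_le_iff lift.sub_le_iff M_lift_D M_lift_Cod factors_through_Fa_iff)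

lemma sub_delta_in_carrier:
  assumes "X \<in> Ob A" "Q \<in> carrier (sub C M (Fo X))"
  shows "sub_delta A C M Fo Fa X Q \<in> carrier (sub A MA X)"
proof -
  obtain n where n: "n \<in> M" "Cod C n = Fo X" "Q = sub_iso C M (Fo X) `` {n}"
    using assms(2) by (rule sub_carrierE)
  show ?thesis
    by (rule obtain_lift[OF assms(1) n(1,2)]) (simp add: n(3) lift.sub_cls_in_carrier)
qed

lemma sub_gamma_delta:
  assumes "X \<in> Ob A" "Q \<in> carrier (sub C M (Fo X))"
  shows "sub_gamma C M Fo Fa X (sub_delta A C M Fo Fa X Q) = Q"
proof -
  obtain n where n: "n \<in> M" "Cod C n = Fo X" "Q = sub_iso C M (Fo X) `` {n}"
    using assms(2) by (rule sub_carrierE)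
  show ?thesis
    by (rule obtain_lift[OF assms(1) n(1,2)]) (simp add: n(3) sub_gamma_cls)
qed

text \<open>With \<open>p\<close> an initial lift of \<open>n\<close>, both sides say that
  \<open>m\<close> factors through \<open>p\<close>, once in \<open>A\<close> and once after
  applying \<open>Fa\<close>.\<close>

lemma sub_le_delta_iff:
  assumes X: "X \<in> Ob A" and P: "P \<in> carrier (sub A MA X)" and Q: "Q \<in> carrier (sub C M (Fo X))"
  shows "P \<sqsubseteq>\<^bsub>sub A MA X\<^esub> sub_delta A C M Fo Fa X Q \<longleftrightarrow>
    sub_gamma C M Fo Fa X P \<sqsubseteq>\<^bsub>sub C M (Fo X)\<^esub> Q"
proof -
  obtain m where m: "m \<in> MA" "Cod A m = X" "P = sub_iso A MA X `` {m}"
    using P by (rule lift.sub_carrierE)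
  obtain n where n: "n \<in> M" "Cod C n = Fo X" "Q = sub_iso C M (Fo X) `` {n}"
    using Q by (rule sub_carrierE)
  obtain p where p: "p \<in> MA" "Cod A p = X" "Fa p = n"
    "sub_delta A C M Fo Fa X Q = sub_iso A MA X `` {p}"
    using obtain_lift[OF X n(1,2)] n(3) by blast
  show ?thesis
    unfolding p(4) unfolding m(3) n(3) sub_gamma_cls[OF m(1,2)] p(3)[symmetric]
    using m p(1,2) M_lift_D M_lift_Cod
    by (simp add: sub_le_iff lift.sub_le_iff factors_through_Fa_iff)
qed

text \<open>\<open>Fa\<close> sends an \<open>(EA, MA)\<close>-factorization of
  \<open>f \<cdot> m\<close> to an \<open>(E, M)\<close>-factorization of its image, and by
  \<open>sub_image_cls\<close> any factorization computes the image.\<close>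

lemma sub_gamma_image:
  assumes f: "f \<in> Hom A X Y" and P: "P \<in> carrier (sub A MA X)"
  shows "sub_gamma C M Fo Fa Y (sub_image A EA MA f P) =
    sub_image C E M (Fa f) (sub_gamma C M Fo Fa X P)"
proof -
  obtain m where m: "m \<in> MA" "Cod A m = X" "P = sub_iso A MA X `` {m}"
    using P by (rule lift.sub_carrierE)
  obtain m' e where m': "m' \<in> MA" "e \<in> EA" "Cod A e = Dom A m'" "f \<cdot>\<^bsub>A\<^esub> m = m' \<cdot>\<^bsub>A\<^esub> e"
    "Cod A m' = Y" "sub_image A EA MA f P = sub_iso A MA Y `` {m'}"
    using lift.obtain_image[OF f m(1,2)] m(3) by blast
  have e: "e \<in> Ar A" "Fa e \<in> E"
    using m'(2) by (auto simp: E_lift_def)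
  have "Fa f \<cdot>\<^bsub>C\<^esub> Fa m = Fa m' \<cdot>\<^bsub>C\<^esub> Fa e"
    using m'(3,4) f m(2) e Fa_Comp_Ar[of m f] Fa_Comp_Ar[of e m']
      M_lift_D(1)[OF m(1)] M_lift_D(1)[OF m'(1)] by (simp add: Hom_iff)
  moreover have "Cod C (Fa e) = Dom C (Fa m')"
    using m' e M_lift_D(1) by (simp add: Fa_Ar)
  ultimately have "sub_image C E M (Fa f) (sub_iso C M (Fo X) `` {Fa m}) =
      sub_iso C M (Fo Y) `` {Fa m'}"
    using sub_image_cls(2)[OF Fa_in_Hom[OF f]] m m' e M_lift_D(2) M_lift_Cod by blast
  then show ?thesis
    unfolding m'(6) sub_gamma_cls[OF m'(1,5)] unfolding m(3) sub_gamma_cls[OF m(1,2)] by simp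
qed

text \<open>Each axiom is an inequality with \<delta> on the right. Transposed to \<open>C\<close>,
  it reduces to the same axiom for \<open>c\<close>.\<close>

lemma lifted_closure_operator:
  assumes c: "closure_operator C E M c"
  shows "closure_operator A EA MA
    (\<lambda>X P. sub_delta A C M Fo Fa X (c (Fo X) (sub_gamma C M Fo Fa X P)))"
proof -
  let ?\<gamma> = "sub_gamma C M Fo Fa" and ?\<delta> = "sub_delta A C M Fo Fa"
  have c_in: "c (Fo X) (?\<gamma> X P) \<in> carrier (sub C M (Fo X))"
    if "X \<in> Ob A" "P \<in> carrier (sub A MA X)" for X P
    using closure_operator_closed[OF c Fo_in_Ob[OF that(1)] sub_gamma_in_carrier[OF that(2)]] .
  have d_in: "?\<delta> X (c (Fo X) (?\<gamma> X P)) \<in> carrier (sub A MA X)"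
    if "X \<in> Ob A" "P \<in> carrier (sub A MA X)" for X P
    using sub_delta_in_carrier[OF that(1) c_in[OF that]] .
  show ?thesis
    unfolding closure_operator_def
  proof (intro conjI ballI impI)
    fix X assume X: "X \<in> Ob A"
    show "(\<lambda>P. ?\<delta> X (c (Fo X) (?\<gamma> X P))) \<in> carrier (sub A MA X) \<rightarrow> carrier (sub A MA X)"
      using d_in[OF X] by blast
    fix P assume P: "P \<in> carrier (sub A MA X)"
    show "P \<sqsubseteq>\<^bsub>sub A MA X\<^esub> ?\<delta> X (c (Fo X) (?\<gamma> X P))"
      unfolding sub_le_delta_iff[OF X P c_in[OF X P]]
      using c Fo_in_Ob[OF X] sub_gamma_in_carrier[OF P] unfolding closure_operator_def by blast
    show "?\<delta> X (c (Fo X) (?\<gamma> X P)) \<sqsubseteq>\<^bsub>sub A MA X\<^esub> ?\<delta> X (c (Fo X) (?\<gamma> X Q))"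
      if Q: "Q \<in> carrier (sub A MA X)" and le: "P \<sqsubseteq>\<^bsub>sub A MA X\<^esub> Q" for Q
      unfolding sub_le_delta_iff[OF X d_in[OF X P] c_in[OF X Q]] sub_gamma_delta[OF X c_in[OF X P]]
      using c Fo_in_Ob[OF X] sub_gamma_in_carrier[OF P] sub_gamma_in_carrier[OF Q]
        sub_gamma_mono[OF P Q le] unfolding closure_operator_def by blast
    fix Y f assume Y: "Y \<in> Ob A" and f: "f \<in> Hom A X Y"
    have fP: "sub_image A EA MA f P \<in> carrier (sub A MA Y)"
      using lift.sub_image_in_carrier[OF f P] .
    have fd: "sub_image A EA MA f (?\<delta> X (c (Fo X) (?\<gamma> X P))) \<in> carrier (sub A MA Y)"
      using lift.sub_image_in_carrier[OF f d_in[OF X P]] .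
    show "sub_image A EA MA f (?\<delta> X (c (Fo X) (?\<gamma> X P))) \<sqsubseteq>\<^bsub>sub A MA Y\<^esub>
        ?\<delta> Y (c (Fo Y) (?\<gamma> Y (sub_image A EA MA f P)))"
      unfolding sub_le_delta_iff[OF Y fd c_in[OF Y fP]]
      \<comment> \<open>Moving \<gamma> inside the images and cancelling it against \<delta> leaves
        (C3) of \<open>c\<close> for the arrow \<open>Fa f\<close>.\<close>
      unfolding sub_gamma_image[OF f d_in[OF X P]] sub_gamma_image[OF f P]
        sub_gamma_delta[OF X c_in[OF X P]]
      using c Fo_in_Ob[OF X] Fo_in_Ob[OF Y] Fa_in_Hom[OF f] sub_gamma_in_carrier[OF P]
      by (simp only: closure_operator_def)
  qed
qed

end

theorem proposition12:
  fixes A :: "('p, 'b) cat" and C :: "('o, 'a) cat" and E M :: "'a set"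
    and Fo :: "'p \<Rightarrow> 'o" and Fa :: "'b \<Rightarrow> 'a"
    and S :: "'o \<Rightarrow> ('a set \<Rightarrow> 'a set \<Rightarrow> bool) set"
    and R :: "'o \<Rightarrow> 'a set \<Rightarrow> 'a set \<Rightarrow> bool"
  assumes "M_complete_category C E M"
    and "faithful_M_fibration A C M Fo Fa"
    and "simple_coperfect_syntopogenous C M S R"
  shows "closure_operator A (E_lift A E Fa) (M_lift A C M Fo Fa) (lifted_closure A C M Fo Fa R)
    \<and> idempotent_closure A (M_lift A C M Fo Fa) (lifted_closure A C M Fo Fa R)
    \<and> continuous_functor A C M Fo Fa
           (lifted_closure A C M Fo Fa R) (topogenous_closure C M R)
    \<and> (\<forall>c'. closure_operator A (E_lift A E Fa) (M_lift A C M Fo Fa) c' \<and>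
           continuous_functor A C M Fo Fa c' (topogenous_closure C M R) \<longrightarrow>
           closure_le A (M_lift A C M Fo Fa) c' (lifted_closure A C M Fo Fa R))"
proof -
  interpret M_complete_category C E M by fact
  interpret faithful_M_fibration A C M Fo Fa by fact
  interpret lifted_factorization A C E M Fo Fa by unfold_locales
  let ?c = "topogenous_closure C M R" and ?l = "lifted_closure A C M Fo Fa R"
  let ?\<gamma> = "sub_gamma C M Fo Fa"
  have R: "topogenous_order C M R" "Meet_preserving C M R" "interpolative C M R"
    using assms(3) by (auto simp: simple_coperfect_syntopogenous_def)
  have l: "?l = (\<lambda>X P. sub_delta A C M Fo Fa X (?c (Fo X) (?\<gamma> X P)))"
    by (intro ext) (simp add: lifted_closure_def)
  have c_in: "?c (Fo X) Q \<in> carrier (sub C M (Fo X))" if "X \<in> Ob A" for X Q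
    using topogenous_closure_in_carrier[OF R(1,2) Fo_in_Ob[OF that]] .
  \<comment> \<open>The lifted closure lies exactly over \<open>?c\<close>. Hence continuity holds
    with equality, and iterating \<open>?l\<close> amounts to iterating \<open>?c\<close>
    below.\<close>
  have \<gamma>l: "?\<gamma> X (?l X P) = ?c (Fo X) (?\<gamma> X P)" if "X \<in> Ob A" for X P
    unfolding l by (rule sub_gamma_delta[OF that c_in[OF that]])
  show ?thesis
  proof (intro conjI allI impI)
    show "closure_operator A EA MA ?l"
      unfolding l by (rule lifted_closure_operator[OF topogenous_closure_operator[OF R(1,2)]])
    show "idempotent_closure A MA ?l"
      unfolding idempotent_closure_def
    proof (intro ballI)
      fix X P assume X: "X \<in> Ob A" and P: "P \<in> carrier (sub A MA X)"
      have "?c (Fo X) (?c (Fo X) (?\<gamma> X P)) = ?c (Fo X) (?\<gamma> X P)"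
        using topogenous_closure_idempotent[OF R] Fo_in_Ob[OF X] sub_gamma_in_carrier[OF P]
        unfolding idempotent_closure_def by blast
      then show "?l X (?l X P) = ?l X P"
        using \<gamma>l[OF X, of P] by (simp add: lifted_closure_def)
    qed
    show "continuous_functor A C M Fo Fa ?l ?c"
      unfolding continuous_functor_def using \<gamma>l c_in sub_le_refl by auto
    fix c' assume c': "closure_operator A EA MA c' \<and> continuous_functor A C M Fo Fa c' ?c"
    show "closure_le A MA c' ?l"
      unfolding closure_le_def
    proof (intro ballI)
      fix X P assume X: "X \<in> Ob A" and P: "P \<in> carrier (sub A MA X)"
      \<comment> \<open>The adjunction \<open>sub_le_delta_iff\<close> speaks of subobjects, so the
        closure of \<open>P\<close> under \<open>c'\<close> has to be one before continuity can be
        transposed.\<close>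
      have "c' X P \<in> carrier (sub A MA X)"
        using closure_operator_closed[OF _ X P] c' by blast
      moreover have "?\<gamma> X (c' X P) \<sqsubseteq>\<^bsub>sub C M (Fo X)\<^esub> ?c (Fo X) (?\<gamma> X P)"
        using c' X P unfolding continuous_functor_def by blast
      ultimately show "c' X P \<sqsubseteq>\<^bsub>sub A MA X\<^esub> ?l X P"
        unfolding lifted_closure_def using sub_le_delta_iff[OF X _ c_in[OF X]] by blast
    qed
  qed
qed

end
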